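(* Let $X$ be a Tychonoff space. The following are equivalent: (1) $B(X)$ satisfies $S_{1}(\mathcal{S},\mathcal{A})$ and is sequentially separable; (2) $X$ satisfies $S_{1}(\mathcal{B}_{\Gamma},\mathcal{B})$ and $X$ has the $O$-property; (3) $B(X)$ is sequentially separable and satisfies $S_{1}(\Gamma_f,\mathcal{B}_f)$ for every $f\in B(X)$; (4) $B(X)$ is sequentially separable and satisfies $S_{1}(\mathcal{S},\mathcal{B}_f)$ for every $f\in B(X)$.
   Context: $B(X)$ is the set of all Baire functions on $X$, i.e. the smallest class of functions $X\to\mathbb{R}$ containing all continuous functions and closed under pointwise limits of sequences, with the topology of pointwise convergence (subspace topology from $\mathbb{R}^X$). A Baire set of $X$ is a member of the $\sigma$-algebra generated by the zero-sets of continuous real-valued functions on $X$. Covers are nontrivial: $X$ is not a member of the cover. $\mathcal{B}$ is the family of countable covers of $X$ by Baire sets. A $\gamma$-cover is an infinite cover $\mathcal{U}$ such that each $x\in X$ belongs to all but finitely many elements of $\mathcal{U}$. $\mathcal{B}_{\Gamma}$ is the family of countable $\gamma$-covers of $X$ by Baire sets. $X$ has the $O$-property if there is a bijection $\varphi$ from $X$ onto a separable metrizable space $Y$ such that $\varphi^{-1}(U)$ is a Baire set of $X$ for every open $U\subseteq Y$, and $\varphi(T)$ is an $F_\sigma$-set of $Y$ for every Baire set $T$ of $X$. A subset $D$ of a space $Y$ is sequentially dense if every point of $Y$ is the limit of a sequence of points of $D$; $Y$ is sequentially separable if it has a countable sequentially dense subset. $\mathcal{S}$ is the family of countable sequentially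 dense subsets of $B(X)$. A set $A\subseteq B(X)$ is $1$-dense in $B(X)$ if for each $x\in X$ and each nonempty open $W\subseteq\mathbb{R}$ there is $g\in A$ with $g(x)\in W$. $\mathcal{A}$ is the family of countable $1$-dense subsets of $B(X)$. For $f\in B(X)$: $\mathcal{B}_f$ is the family of countable $B\subseteq B(X)$ such that for each $x\in X$ and $\epsilon>0$ there is $h\in B$ with $|h(x)-f(x)|<\epsilon$; $\Gamma_f$ is the family of countably infinite $A\subseteq B(X)$ with $f\notin A$ such that $A\setminus U$ is finite for each neighborhood $U$ of $f$. $S_1(\mathcal{P},\mathcal{Q})$: for each sequence $(A_n)_{n\in\omega}$ of elements of $\mathcal{P}$ there are $b_n\in A_n$ ($n\in\omega$) such that $\{b_n:n\in\omega\}\in\mathcal{Q}$. *)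

theory Defs
  imports "HOL-Analysis.Analysis"
begin

text \<open>Real-valued functions on a space \<open>X\<close> are represented by functions that are
  \<^const>\<open>extensional\<close> on \<^term>\<open>topspace X\<close>, i.e. by the points of
  \<^term>\<open>powertop_real (topspace X)\<close>.\<close>

inductive_set Baire_functions :: "'a topology \<Rightarrow> ('a \<Rightarrow> real) set" for X where
  continuous: "continuous_map X euclideanreal f \<Longrightarrow> restrict f (topspace X) \<in> Baire_functions X"
| limit: "(\<And>n. F n \<in> Baire_functions X) \<Longrightarrow> f \<in> extensional (topspace X) \<Longrightarrow>
    (\<And>x. x \<in> topspace X \<Longrightarrow> (\<lambda>n::nat. F n x) \<longlonglongrightarrow> f x) \<Longrightarrow> f \<in> Baire_functions X"

definition Baire_function_space :: "'a topology \<Rightarrow> ('a \<Rightarrow> real) topology" where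
  "Baire_function_space X = subtopology (powertop_real (topspace X)) (Baire_functions X)"

definition zero_sets :: "'a topology \<Rightarrow> 'a set set" where
  "zero_sets X = {{x \<in> topspace X. f x = 0} | f. continuous_map X euclideanreal f}"

definition Baire_sets :: "'a topology \<Rightarrow> 'a set set" where
  "Baire_sets X = sigma_sets (topspace X) (zero_sets X)"

definition nontrivial_cover :: "'a topology \<Rightarrow> 'a set set \<Rightarrow> bool" where
  "nontrivial_cover X \<U> \<longleftrightarrow> \<Union>\<U> = topspace X \<and> topspace X \<notin> \<U>"

definition gamma_cover :: "'a topology \<Rightarrow> 'a set set \<Rightarrow> bool" where
  "gamma_cover X \<U> \<longleftrightarrow> nontrivial_cover X \<U> \<and> infinite \<U> \<and>
     (\<forall>x \<in> topspace X. finite {U \<in> \<U>. x \<notin> U})"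

definition Baire_covers :: "'a topology \<Rightarrow> 'a set set set" where
  "Baire_covers X = {\<U>. countable \<U> \<and> \<U> \<subseteq> Baire_sets X \<and> nontrivial_cover X \<U>}"

definition Baire_gamma_covers :: "'a topology \<Rightarrow> 'a set set set" where
  "Baire_gamma_covers X = {\<U>. countable \<U> \<and> \<U> \<subseteq> Baire_sets X \<and> gamma_cover X \<U>}"

text \<open>The space \<open>Y\<close> is taken on the same type as \<open>X\<close>. This loses no generality, because \<open>Y\<close> is
  in bijection with \<open>X\<close> and its topology can be transported along the bijection.\<close>

definition O_property :: "'a topology \<Rightarrow> bool" where
  "O_property X \<longleftrightarrow>
     (\<exists>(Y :: 'a topology) \<phi>. separable_space Y \<and> metrizable_space Y \<and>
        bij_betw \<phi> (topspace X) (topspace Y) \<and>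
        (\<forall>U. openin Y U \<longrightarrow> {x \<in> topspace X. \<phi> x \<in> U} \<in> Baire_sets X) \<and>
        (\<forall>T \<in> Baire_sets X. fsigma_in Y (\<phi> ` T)))"

definition sequentially_dense_in :: "'a topology \<Rightarrow> 'a set \<Rightarrow> bool" where
  "sequentially_dense_in Y D \<longleftrightarrow> D \<subseteq> topspace Y \<and>
     (\<forall>y \<in> topspace Y. \<exists>s. (\<forall>n. s n \<in> D) \<and> limitin Y s y sequentially)"

definition sequentially_separable_space :: "'a topology \<Rightarrow> bool" where
  "sequentially_separable_space Y \<longleftrightarrow> (\<exists>D. countable D \<and> sequentially_dense_in Y D)"

definition sequentially_dense_family :: "'a topology \<Rightarrow> ('a \<Rightarrow> real) set set" where
  "sequentially_dense_family X =
     {D. countable D \<and> sequentially_dense_in (Baire_function_space X) D}"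

definition one_dense_family :: "'a topology \<Rightarrow> ('a \<Rightarrow> real) set set" where
  "one_dense_family X =
     {A. countable A \<and> A \<subseteq> Baire_functions X \<and>
         (\<forall>x \<in> topspace X. \<forall>W. open W \<and> W \<noteq> {} \<longrightarrow> (\<exists>g \<in> A. g x \<in> W))}"

definition one_approximating_family :: "'a topology \<Rightarrow> ('a \<Rightarrow> real) \<Rightarrow> ('a \<Rightarrow> real) set set" where
  "one_approximating_family X f =
     {B. countable B \<and> B \<subseteq> Baire_functions X \<and>
         (\<forall>x \<in> topspace X. \<forall>\<epsilon>>0. \<exists>h \<in> B. \<bar>h x - f x\<bar> < \<epsilon>)}"

definition converging_family :: "'a topology \<Rightarrow> ('a \<Rightarrow> real) \<Rightarrow> ('a \<Rightarrow> real) set set" where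
  "converging_family X f =
     {A. countable A \<and> infinite A \<and> A \<subseteq> Baire_functions X \<and> f \<notin> A \<and>
         (\<forall>U. openin (Baire_function_space X) U \<and> f \<in> U \<longrightarrow> finite (A - U))}"

definition S1 :: "'a set set \<Rightarrow> 'a set set \<Rightarrow> bool" where
  "S1 \<P> \<Q> \<longleftrightarrow>
     (\<forall>A :: nat \<Rightarrow> 'a set. (\<forall>n. A n \<in> \<P>) \<longrightarrow> (\<exists>b. (\<forall>n. b n \<in> A n) \<and> range b \<in> \<Q>))"

definition Tychonoff_space :: "'a topology \<Rightarrow> bool" where
  "Tychonoff_space X \<longleftrightarrow> completely_regular_space X \<and> Hausdorff_space X"

end

theory Submission
  imports Defs
begin

text \<open>The theorem splits into two independent facts about a Tychonoff space \<open>X\<close>.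

  First, \<open>B(X)\<close> is sequentially separable if and only if \<open>X\<close> has the \<open>O\<close>-property
  (\<open>O_property_iff_sequentially_separable\<close>). Both are equivalent to the existence of Baire sets
  \<open>B 0, B 1, \<dots>\<close> such that every Baire set is a countable union of sets
  \<open>X - (\<Union>i\<in>I. B i)\<close>. The \<open>O\<close>-property supplies them as preimages of a countable base, and
  conversely \<open>X\<close> inherits a suitable topology from \<open>\<real>\<^sup>\<nat>\<close> along the indicators of the \<open>B i\<close>,
  because these sets separate the points of a Tychonoff space. A countable sequentially dense set
  \<open>D\<close> supplies them as the sets \<open>{d < 1/2}\<close> with \<open>d \<in> D\<close>.
  Conversely, the rational-valued functions that depend on membership in finitely many \<open>B i\<close> are
  sequentially dense: that \<open>x\<close> avoids all \<open>B i\<close> with \<open>i \<in> I\<close> can be refuted at a finite stage,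
  so the least index of a piece containing \<open>x\<close> is computed correctly in the limit, and with it a
  value close to \<open>f x\<close>.

  Secondly, once \<open>B(X)\<close> is sequentially separable, each of the function-space selection principles
  is equivalent to \<open>S\<^sub>1(\<B>\<^sub>\<Gamma>, \<B>)\<close>. From covers to functions
  (\<open>S1_gamma_approximating_choice\<close>): if \<open>a n k \<longlonglongrightarrow> f\<close> as \<open>k\<close> grows, the
  sets \<open>{\<bar>a n k - f\<bar> < \<epsilon>}\<close> form a \<open>\<gamma>\<close>-cover for each \<open>n\<close>, unless one of them is the whole space;
  selecting from these covers, over
  separate blocks of indices for each target function and each \<open>\<epsilon>\<close>, selects approximating
  functions. From functions to covers, a \<open>\<gamma>\<close>-cover is coded by functions that are at least \<open>1\<close> off
  one of its members, so that smallness at a point reveals a member containing it: indicators of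
  complements converge to zero (\<open>S1_converging_imp_S1_gamma\<close>), and members of a sequentially dense
  set modified to be \<open>1\<close> off a member of the cover are again sequentially dense
  (\<open>S1_dense_imp_S1_gamma\<close>).\<close>

section \<open>Baire functions are the Baire measurable functions\<close>

definition Baire_algebra :: "'a topology \<Rightarrow> 'a measure" where
  "Baire_algebra X = sigma (topspace X) (zero_sets X)"

lemma space_Baire_algebra [simp]: "space (Baire_algebra X) = topspace X"
  by (simp add: Baire_algebra_def space_measure_of_conv)

lemma sets_Baire_algebra: "sets (Baire_algebra X) = Baire_sets X"
  unfolding Baire_algebra_def Baire_sets_def
  by (rule sets_measure_of) (auto simp: zero_sets_def)

lemma continuous_imp_Baire_measurable:
  assumes "continuous_map X euclideanreal f"
  shows "f \<in> borel_measurable (Baire_algebra X)"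
  unfolding borel_measurable_iff_le
proof
  fix a
  have "continuous_map X euclideanreal (\<lambda>x. max 0 (f x - a))"
    by (intro continuous_map_real_max continuous_map_diff assms) auto
  then have "{x \<in> topspace X. max 0 (f x - a) = 0} \<in> zero_sets X"
    unfolding zero_sets_def by (intro CollectI exI[of _ "\<lambda>x. max 0 (f x - a)"]) simp
  moreover have "{x \<in> topspace X. max 0 (f x - a) = 0} = {x \<in> topspace X. f x \<le> a}"
    by (auto simp: max_def split: if_splits)
  ultimately show "{x \<in> space (Baire_algebra X). f x \<le> a} \<in> sets (Baire_algebra X)"
    by (simp add: sets_Baire_algebra Baire_sets_def sigma_sets.Basic)
qed

lemma Baire_function_imp_measurable:
  "f \<in> Baire_functions X \<Longrightarrow> f \<in> extensional (topspace X) \<inter> borel_measurable (Baire_algebra X)"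
proof (induction rule: Baire_functions.induct)
  case (continuous f)
  then have "f \<in> borel_measurable (Baire_algebra X)"
    by (rule continuous_imp_Baire_measurable)
  moreover have "restrict f (topspace X) \<in> borel_measurable (Baire_algebra X) \<longleftrightarrow>
      f \<in> borel_measurable (Baire_algebra X)"
    by (rule measurable_cong) simp
  ultimately show ?case by (intro IntI restrict_extensional) (simp only:)
next
  case (limit F f)
  have "f \<in> borel_measurable (Baire_algebra X)"
  proof (rule borel_measurable_LIMSEQ_real)
    show "F n \<in> borel_measurable (Baire_algebra X)" for n
      using limit.IH by (rule IntD2)
    show "(\<lambda>n. F n x) \<longlonglongrightarrow> f x" if "x \<in> space (Baire_algebra X)" for x
      using that limit.hyps by simp
  qed
  with limit.hyps(2) show ?case by (rule IntI)
qed

lemma Baire_functions_restrict_cong: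
  assumes "f \<in> Baire_functions X" "\<And>x. x \<in> topspace X \<Longrightarrow> f x = g x"
  shows "restrict g (topspace X) \<in> Baire_functions X"
proof -
  have "f \<in> extensional (topspace X)"
    using Baire_function_imp_measurable[OF assms(1)] by (rule IntD1)
  then have "f = restrict g (topspace X)"
    using assms(2) by (intro extensionalityI[OF _ restrict_extensional]) (simp_all only: restrict_apply')
  then show ?thesis using assms(1) by (simp only:)
qed

lemma Baire_functions_restrict_limit:
  fixes F :: "nat \<Rightarrow> 'a \<Rightarrow> real"
  assumes F: "\<And>n. restrict (F n) (topspace X) \<in> Baire_functions X"
    and lim: "\<And>x. x \<in> topspace X \<Longrightarrow> (\<lambda>n. F n x) \<longlonglongrightarrow> f x"
  shows "restrict f (topspace X) \<in> Baire_functions X"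
proof (rule Baire_functions.limit[OF F restrict_extensional])
  fix x assume "x \<in> topspace X"
  with lim show "(\<lambda>n. restrict (F n) (topspace X) x) \<longlonglongrightarrow> restrict f (topspace X) x"
    by (simp only: restrict_apply')
qed

text \<open>The classical two-step induction: with \<open>g\<close> continuous, induct over the generation of \<open>f\<close>; then
  keep a Baire function \<open>f\<close> fixed and induct over the generation of \<open>g\<close>. This replaces separate
  closure proofs for sums, products and lattice operations.\<close>
lemma Baire_functions_compose2:
  fixes h :: "real \<times> real \<Rightarrow> real"
  assumes h: "continuous_on UNIV h"
    and f: "restrict f (topspace X) \<in> Baire_functions X"
    and g: "restrict g (topspace X) \<in> Baire_functions X"
  shows "restrict (\<lambda>x. h (f x, g x)) (topspace X) \<in> Baire_functions X"
proof -
  have h_lim: "(\<lambda>n. h (a n, b n)) \<longlonglongrightarrow> h (a', b')" if "a \<longlonglongrightarrow> a'" "b \<longlonglongrightarrow> b'"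
    for a b :: "nat \<Rightarrow> real" and a' b'
    using continuous_on_tendsto_compose[OF h tendsto_Pair[OF that]] by simp
  have cont: "restrict (\<lambda>x. h (f x, g x)) (topspace X) \<in> Baire_functions X"
    if g: "continuous_map X euclideanreal g" and f: "f \<in> Baire_functions X" for f g
    using f
  proof (induction rule: Baire_functions.induct)
    case (continuous f)
    have "continuous_map X euclidean (\<lambda>x. (f x, g x))"
      using continuous_map_pairedI[OF continuous g] by simp
    then have "continuous_map X euclidean (h \<circ> (\<lambda>x. (f x, g x)))"
      using h by (intro continuous_map_compose) auto
    from Baire_functions.continuous[OF this] show ?case
      by (rule Baire_functions_restrict_cong) (simp only: restrict_apply' o_apply)
  next
    case (limit F f)
    then show ?case by (intro Baire_functions_restrict_limit[OF limit.IH] h_lim tendsto_const)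
  qed
  have "restrict (\<lambda>x. h (restrict f (topspace X) x, g x)) (topspace X) \<in> Baire_functions X"
    if "g \<in> Baire_functions X" for g
    using that
  proof (induction rule: Baire_functions.induct)
    case (continuous g)
    from cont[OF this f] show ?case
      by (rule Baire_functions_restrict_cong) (simp only: restrict_apply')
  next
    case (limit F g)
    then show ?case by (intro Baire_functions_restrict_limit[OF limit.IH] h_lim tendsto_const)
  qed
  from this[OF g] show ?thesis
    by (rule Baire_functions_restrict_cong) (simp only: restrict_apply')
qed

lemma Baire_functions_const: "restrict (\<lambda>x. c) (topspace X) \<in> Baire_functions X"
  by (intro Baire_functions.continuous continuous_map_const[THEN iffD2]) simp

text \<open>For a zero-set \<open>A = {f = 0}\<close> the indicator is the limit of the continuous functions
  \<open>max 0 (1 - n\<bar>f\<bar>)\<close>; complements and countable unions are handled by algebra, maxima and limits.\<close>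
lemma indicator_in_Baire_functions:
  assumes "A \<in> Baire_sets X"
  shows "restrict (indicator A) (topspace X) \<in> Baire_functions X"
  using assms unfolding Baire_sets_def
proof (induction rule: sigma_sets.induct)
  case (Basic A)
  then obtain f where f: "continuous_map X euclideanreal f" and A: "A = {x \<in> topspace X. f x = 0}"
    by (auto simp: zero_sets_def)
  have lim: "(\<lambda>n. max 0 (1 - real n * \<bar>f x\<bar>)) \<longlonglongrightarrow> indicator A x" if x: "x \<in> topspace X" for x
  proof (cases "f x = 0")
    case False
    then obtain N where N: "1 < real N * \<bar>f x\<bar>"
      using ex_less_of_nat_mult[of "\<bar>f x\<bar>" 1] by auto
    have "1 - real n * \<bar>f x\<bar> \<le> 0" if "n \<ge> N" for n
      using N mult_right_mono[of "real N" "real n" "\<bar>f x\<bar>"] that by auto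
    then have "\<forall>\<^sub>F n in sequentially. max 0 (1 - real n * \<bar>f x\<bar>) = indicator A x"
      using False A by (intro eventually_sequentiallyI[of N]) (simp add: max_absorb1)
    then show ?thesis by (rule tendsto_eventually)
  qed (use x A in auto)
  have "restrict (\<lambda>x. max 0 (1 - real n * \<bar>f x\<bar>)) (topspace X) \<in> Baire_functions X" for n
    by (intro Baire_functions.continuous continuous_map_real_max continuous_map_diff
        continuous_map_real_mult continuous_map_real_abs f continuous_map_const[THEN iffD2]) simp_all
  then show ?case
    by (rule Baire_functions_restrict_limit) (rule lim)
next
  case Empty
  show ?case by (rule Baire_functions_restrict_cong[OF Baire_functions_const[of 0]]) simp
next
  case (Compl A)
  have "restrict (\<lambda>x. (\<lambda>p. 1 - fst p) (indicator A x, 0::real)) (topspace X) \<in> Baire_functions X"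
    by (rule Baire_functions_compose2[where h = "\<lambda>p. 1 - fst p",
        OF _ Compl.IH Baire_functions_const]) (intro continuous_intros)
  then show ?case
    by (rule Baire_functions_restrict_cong) (simp add: indicator_def)
next
  case (Union A)
  have fin: "restrict (indicator (\<Union>i<n. A i)) (topspace X) \<in> Baire_functions X" for n :: nat
  proof (induction n)
    case 0
    show ?case by (rule Baire_functions_restrict_cong[OF Baire_functions_const[of 0]]) simp
  next
    case (Suc n)
    have "restrict (\<lambda>x. (\<lambda>p. max (fst p) (snd p)) (indicator (\<Union>i<n. A i) x, indicator (A n) x))
        (topspace X) \<in> Baire_functions X"
      by (rule Baire_functions_compose2[where h = "\<lambda>p. max (fst p) (snd p)",
          OF _ Suc Union.IH]) (intro continuous_intros)
    then show ?case
      by (rule Baire_functions_restrict_cong) (simp add: indicator_def lessThan_Suc)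
  qed
  show ?case
    by (rule Baire_functions_restrict_limit[OF fin]) (rule LIMSEQ_indicator_UN)
qed

lemma nonneg_measurable_imp_Baire_function:
  fixes u :: "'a \<Rightarrow> real"
  assumes "u \<in> borel_measurable (Baire_algebra X)" and "\<And>x. 0 \<le> u x"
  shows "restrict u (topspace X) \<in> Baire_functions X"
  using assms
proof (induction rule: borel_measurable_induct_real)
  case (set A)
  then show ?case by (intro indicator_in_Baire_functions) (simp only: sets_Baire_algebra)
next
  case (mult u c)
  have "restrict (\<lambda>x. (\<lambda>p. c * fst p) (u x, 0::real)) (topspace X) \<in> Baire_functions X"
    by (rule Baire_functions_compose2[where h = "\<lambda>p. c * fst p",
        OF _ mult.IH Baire_functions_const]) (intro continuous_intros)
  then show ?case by (simp only: fst_conv)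
next
  case (add u v)
  have "restrict (\<lambda>x. (\<lambda>p. fst p + snd p) (v x, u x)) (topspace X) \<in> Baire_functions X"
    by (rule Baire_functions_compose2[where h = "\<lambda>p. fst p + snd p",
        OF _ add.IH(2) add.IH(1)]) (intro continuous_intros)
  then show ?case by (simp only: fst_conv snd_conv)
next
  case (seq U)
  show ?case
    by (rule Baire_functions_restrict_limit[where F = U, OF seq.IH]) (simp add: seq.hyps)
qed

text \<open>The Lebesgue-Hausdorff characterization. It lets the usual measurability calculus
  decide membership in \<^term>\<open>Baire_functions X\<close>.\<close>
lemma Baire_functions_eq:
  "Baire_functions X = extensional (topspace X) \<inter> borel_measurable (Baire_algebra X)"
proof (intro equalityI subsetI)
  fix f :: "'a \<Rightarrow> real"
  assume f: "f \<in> extensional (topspace X) \<inter> borel_measurable (Baire_algebra X)"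
  then have [measurable]: "f \<in> borel_measurable (Baire_algebra X)" by simp
  have pos: "restrict (\<lambda>x. max 0 (f x)) (topspace X) \<in> Baire_functions X"
   and neg: "restrict (\<lambda>x. max 0 (- f x)) (topspace X) \<in> Baire_functions X"
    by (rule nonneg_measurable_imp_Baire_function; simp)+
  have "restrict (\<lambda>x. (\<lambda>p. fst p - snd p) (max 0 (f x), max 0 (- f x))) (topspace X)
      \<in> Baire_functions X"
    by (rule Baire_functions_compose2[where h = "\<lambda>p. fst p - snd p", OF _ pos neg]) (intro continuous_intros)
  then have "restrict f (topspace X) \<in> Baire_functions X"
    by (rule Baire_functions_restrict_cong) (simp add: max_def)
  with f show "f \<in> Baire_functions X" by (simp add: extensional_restrict)
qed (rule Baire_function_imp_measurable)

lemma topspace_Baire_function_space [simp]: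
  "topspace (Baire_function_space X) = Baire_functions X"
  by (auto simp: Baire_function_space_def Baire_functions_eq PiE_def extensional_def)

lemma limitin_Baire_function_space:
  assumes "\<And>n. s n \<in> Baire_functions X"
  shows "limitin (Baire_function_space X) s f sequentially \<longleftrightarrow>
    f \<in> Baire_functions X \<and> (\<forall>x \<in> topspace X. (\<lambda>n. s n x) \<longlonglongrightarrow> f x)"
  using assms
  by (auto simp: Baire_function_space_def limitin_subtopology limitin_componentwise Baire_functions_eq
      PiE_def)

lemma Baire_sets_vimage_open:
  assumes "f \<in> Baire_functions X" "open W"
  shows "{x \<in> topspace X. f x \<in> W} \<in> Baire_sets X"
  using assms measurable_sets[of f "Baire_algebra X" borel W]
  by (simp add: Baire_functions_eq sets_Baire_algebra vimage_def Int_def conj_commute)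

section \<open>Sequential separability yields a countable generating family\<close>

text \<open>The combinatorial content shared by the \<open>O\<close>-property and by sequential separability: in the
  topology generated by the \<open>B i\<close> every Baire set is \<open>F\<^sub>\<sigma>\<close>, and the closed sets in such a
  representation can be taken to be intersections of complements of the \<open>B i\<close>. Avoiding all \<open>B i\<close>
  with \<open>i \<in> I\<close> is then a condition that fails, if at all, because of a single index.\<close>
definition F_sigma_generating :: "'a topology \<Rightarrow> (nat \<Rightarrow> 'a set) \<Rightarrow> bool" where
  "F_sigma_generating X B \<longleftrightarrow> range B \<subseteq> Baire_sets X \<and>
     (\<forall>T \<in> Baire_sets X. \<exists>I :: nat \<Rightarrow> nat set. T = (\<Union>k. topspace X - (\<Union>i\<in>I k. B i)))"

text \<open>Take \<open>B i = {d i < 1/2}\<close> for an enumeration \<open>d\<close> of a countable sequentially dense set. If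
  \<open>d (j n)\<close> converges to the indicator of a Baire set \<open>T\<close>, then \<open>x \<in> T\<close> iff from some \<open>k\<close> on
  \<open>x\<close> avoids all \<open>B (j n)\<close>, and this is the required representation of \<open>T\<close>.\<close>
lemma sequentially_separable_imp_generating:
  assumes "sequentially_separable_space (Baire_function_space X)"
  shows "\<exists>B. F_sigma_generating X B"
proof -
  obtain D where "countable D" and D: "D \<subseteq> Baire_functions X"
    and lim: "\<And>f. f \<in> Baire_functions X \<Longrightarrow>
      \<exists>s. (\<forall>n. s n \<in> D) \<and> limitin (Baire_function_space X) s f sequentially"
    using assms unfolding sequentially_separable_space_def sequentially_dense_in_def by auto
  from lim[OF Baire_functions_const[of 0]] have "D \<noteq> {}" by blast
  then obtain d :: "nat \<Rightarrow> 'a \<Rightarrow> real" where d: "range d = D"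
    using range_from_nat_into[OF _ \<open>countable D\<close>] by blast
  define B where "B i = {x \<in> topspace X. d i x \<in> {..<1/2}}" for i
  have "B i \<in> Baire_sets X" for i
    unfolding B_def using d D by (intro Baire_sets_vimage_open) auto
  moreover have "\<exists>I :: nat \<Rightarrow> nat set. T = (\<Union>k. topspace X - (\<Union>i\<in>I k. B i))"
    if T: "T \<in> Baire_sets X" for T
  proof -
    obtain s where s: "\<And>n. s n \<in> D"
      and s_lim: "limitin (Baire_function_space X) s (restrict (indicator T) (topspace X)) sequentially"
      using lim[OF indicator_in_Baire_functions[OF T]] by blast
    have "\<forall>n. \<exists>j. s n = d j" using s d by blast
    from choice[OF this] obtain j where "\<forall>n. s n = d (j n)" by (rule exE)
    then have j: "s n = d (j n)" for n by (rule spec)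
    have "s n \<in> Baire_functions X" for n using s D by blast
    then have lim_x: "(\<lambda>n. d (j n) x) \<longlonglongrightarrow> indicator T x" if "x \<in> topspace X" for x
      using s_lim that by (simp add: limitin_Baire_function_space j)
    have "x \<in> T \<longleftrightarrow> (\<exists>k. \<forall>n\<ge>k. x \<notin> B (j n))" if x: "x \<in> topspace X" for x
    proof (cases "x \<in> T")
      case True
      then have "\<forall>\<^sub>F n in sequentially. d (j n) x > 1/2"
        using lim_x[OF x] by (intro order_tendstoD(1)[where y = 1]) auto
      then show ?thesis using True by (fastforce simp: B_def eventually_sequentially)
    next
      case False
      then have "\<forall>\<^sub>F n in sequentially. d (j n) x < 1/2"
        using lim_x[OF x] by (intro order_tendstoD(2)[where y = 0]) auto
      then obtain N where "\<And>n. n \<ge> N \<Longrightarrow> x \<in> B (j n)"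
        using x by (auto simp: B_def eventually_sequentially)
      then have "\<exists>n\<ge>k. x \<in> B (j n)" for k
        by (intro exI[of _ "max k N"]) auto
      then show ?thesis using False by blast
    qed
    moreover have "T \<subseteq> topspace X"
      using T sets.sets_into_space[of T "Baire_algebra X"] by (simp add: sets_Baire_algebra)
    ultimately have "T = {x \<in> topspace X. \<exists>k. \<forall>n\<ge>k. x \<notin> B (j n)}"
      by blast
    also have "\<dots> = (\<Union>k. topspace X - (\<Union>i\<in>j ` {k..}. B i))"
      by (auto simp: Ball_def Bex_def)
    finally have "T = (\<Union>k. topspace X - (\<Union>i\<in>j ` {k..}. B i))" .
    then show ?thesis by (intro exI[of _ "\<lambda>k. j ` {k..}"])
  qed
  ultimately show ?thesis unfolding F_sigma_generating_def by blast
qed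

section \<open>A generating family yields a countable sequentially dense set\<close>

text \<open>Row \<open>m\<close> of \<open>a\<close> is thought of as settling within \<open>1/(m+1)\<close> of an unknown value. At stage \<open>n\<close>
  the finest row that is still consistent with all coarser rows is trusted. The choice uses only
  the entries at stage \<open>n\<close>, not the value itself; this is what keeps the approximating functions
  below in a countable set.\<close>
definition diagonal_limit :: "(nat \<Rightarrow> nat \<Rightarrow> real) \<Rightarrow> nat \<Rightarrow> real" where
  "diagonal_limit a n = a (GREATEST m. m \<le> n \<and>
     (\<forall>j\<le>m. \<bar>a j n - a m n\<bar> \<le> 1 / Suc j + 1 / Suc m)) n"

text \<open>Once rows \<open>0\<close> to \<open>M\<close> have settled at stage \<open>n\<close>, row \<open>M\<close> is consistent, so a row \<open>m \<ge> M\<close> is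
  trusted. Consistency of row \<open>m\<close> with row \<open>M\<close> then bounds its error by \<open>3/(M+1)\<close>.\<close>
lemma diagonal_limit_tendsto:
  assumes a: "\<And>m. \<forall>\<^sub>F n in sequentially. \<bar>a m n - y\<bar> < 1 / Suc m"
  shows "diagonal_limit a \<longlonglongrightarrow> y"
proof (rule tendstoI)
  fix e :: real assume "e > 0"
  then obtain M where M: "3 / Suc M < e"
    using reals_Archimedean[of "e / 3"] by (auto simp: field_simps)
  have "\<forall>\<^sub>F n in sequentially. \<forall>j\<in>{..M}. \<bar>a j n - y\<bar> < 1 / Suc j"
    by (intro eventually_ball_finite ballI a finite_atMost)
  then show "\<forall>\<^sub>F n in sequentially. dist (diagonal_limit a n) y < e"
    using eventually_ge_at_top[of M]
  proof eventually_elim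
    case (elim n)
    define P where "P m \<longleftrightarrow> m \<le> n \<and> (\<forall>j\<le>m. \<bar>a j n - a m n\<bar> \<le> 1 / Suc j + 1 / Suc m)" for m
    define m where "m = (GREATEST m. P m)"
    have "\<bar>a j n - a M n\<bar> \<le> 1 / Suc j + 1 / Suc M" if "j \<le> M" for j
    proof -
      have "\<bar>a j n - y\<bar> < 1 / Suc j" "\<bar>a M n - y\<bar> < 1 / Suc M" using elim(1) that by auto
      then show ?thesis by linarith
    qed
    then have PM: "P M" using elim(2) by (simp add: P_def)
    have bound: "k \<le> n" if "P k" for k using that by (simp add: P_def)
    have "P m" unfolding m_def by (rule GreatestI_nat[where P = P, OF PM bound])
    moreover have "M \<le> m" unfolding m_def by (rule Greatest_le_nat[where P = P, OF PM bound])
    ultimately have "\<bar>a M n - a m n\<bar> \<le> 1 / Suc M + 1 / Suc m" and "1 / Suc m \<le> 1 / Suc M"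
      by (auto simp: P_def frac_le)
    moreover have "\<bar>a M n - y\<bar> < 1 / Suc M" using elim(1) by simp
    ultimately have "\<bar>a m n - y\<bar> < 3 * (1 / Suc M)" by linarith
    then show ?case using M by (simp add: diagonal_limit_def m_def P_def dist_real_def)
  qed
qed

text \<open>Membership of \<open>x\<close> in \<open>- (\<Union>i\<in>I p. B i)\<close> is refuted by a single index, hence after finitely
  many stages. So the least index \<open>p\<close> not refuted by the first \<open>n\<close> sets is eventually the true least
  index. The disjunct \<open>p = n\<close> ensures that a least index exists at every stage.\<close>
lemma least_index_stabilizes:
  fixes B :: "nat \<Rightarrow> 'a set" and I :: "nat \<Rightarrow> nat set"
  assumes "\<exists>p. \<forall>i\<in>I p. x \<notin> B i"
  shows "\<forall>\<^sub>F n in sequentially.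
    (LEAST p. p = n \<or> {i\<in>{..<n}. x \<in> B i} \<inter> I p = {}) = (LEAST p. \<forall>i\<in>I p. x \<notin> B i)"
proof -
  define p0 where "p0 = (LEAST p. \<forall>i\<in>I p. x \<notin> B i)"
  have p0: "\<forall>i\<in>I p0. x \<notin> B i" unfolding p0_def by (rule LeastI_ex) fact
  have "\<forall>p\<in>{..<p0}. \<exists>i. i \<in> I p \<and> x \<in> B i"
    using not_less_Least[where P = "\<lambda>p. \<forall>i\<in>I p. x \<notin> B i"] unfolding p0_def by blast
  from bchoice[OF this] obtain i where i: "\<And>p. p < p0 \<Longrightarrow> i p \<in> I p \<and> x \<in> B (i p)"
    by auto
  have "\<forall>\<^sub>F n in sequentially. \<forall>p\<in>{..<p0}. i p < n"
    by (intro eventually_ball_finite) (auto intro: eventually_gt_at_top)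
  then show ?thesis
    unfolding p0_def[symmetric] using eventually_gt_at_top[of p0]
  proof eventually_elim
    case (elim n)
    show ?case
    proof (rule Least_equality)
      show "p0 = n \<or> {i\<in>{..<n}. x \<in> B i} \<inter> I p0 = {}" using p0 by blast
      show "p0 \<le> p" if p: "p = n \<or> {i\<in>{..<n}. x \<in> B i} \<inter> I p = {}" for p
      proof (rule ccontr)
        assume "\<not> p0 \<le> p"
        then have "p < p0" by simp
        then show False using p i[of p] elim by auto
      qed
    qed
  qed
qed

text \<open>The sequentially dense set consists of the rational-valued functions that depend only on which of
  \<open>B 0, \<dots>, B (n - 1)\<close> contain \<open>x\<close>, for some \<open>n\<close>. To reach a Baire function \<open>f\<close>, cover the space,
  for each \<open>m\<close>, by the closed pieces of the Baire sets \<open>{\<bar>q j - f\<bar> < 1/(m+1)}\<close>. The least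
  piece containing \<open>x\<close> gives an approximate value of \<open>f x\<close>, it is found in finitely many stages by
  \<open>least_index_stabilizes\<close>, and \<open>diagonal_limit\<close> combines all accuracies \<open>m\<close>.\<close>
lemma generating_imp_sequentially_separable:
  assumes "F_sigma_generating X B"
  shows "sequentially_separable_space (Baire_function_space X)"
proof -
  define code where "code n x = {i\<in>{..<n}. x \<in> B i}" for n x
  define D where "D = (\<Union>n. (\<lambda>r. restrict (\<lambda>x. r (code n x)) (topspace X)) `
    (Pow {..<n} \<rightarrow>\<^sub>E (\<rat> :: real set)))"
  have B: "B i \<in> sets (Baire_algebra X)" for i
    using assms by (auto simp: F_sigma_generating_def sets_Baire_algebra)
  have "countable D"
    unfolding D_def by (intro countable_UN countable_image countable_PiE countable_rat) auto
  have code_meas: "code n \<in> measurable (Baire_algebra X) (count_space (Pow {..<n}))" for n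
  proof -
    have "code n x = S \<longleftrightarrow> (\<forall>i. i < n \<longrightarrow> (x \<in> B i) = (i \<in> S))" if "S \<in> Pow {..<n}" for S x
      using that unfolding code_def set_eq_iff mem_Collect_eq lessThan_iff Pow_iff subset_iff by metis
    then have eq: "code n -` {S} \<inter> space (Baire_algebra X) =
        {x \<in> space (Baire_algebra X). \<forall>i. i < n \<longrightarrow> (x \<in> B i) = (i \<in> S)}" if "S \<in> Pow {..<n}" for S
      using that unfolding vimage_def Int_def singleton_iff mem_Collect_eq by (simp add: conj_commute)
    have "{x \<in> space (Baire_algebra X). \<forall>i. i < n \<longrightarrow> (x \<in> B i) = (i \<in> S)}
        \<in> sets (Baire_algebra X)" for S
    proof -
      note [measurable] = B
      show ?thesis by measurable
    qed
    then have "code n -` {S} \<inter> space (Baire_algebra X) \<in> sets (Baire_algebra X)"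
      if "S \<in> Pow {..<n}" for S
      unfolding eq[OF that] .
    moreover have "code n \<in> space (Baire_algebra X) \<rightarrow> Pow {..<n}"
      unfolding code_def by blast
    ultimately show ?thesis
      by (subst measurable_count_space_eq2) (blast intro: finite_Pow_iff[THEN iffD2])+
  qed
  have D_Baire: "D \<subseteq> Baire_functions X"
  proof
    fix f assume "f \<in> D"
    then obtain n r where f: "f = restrict (\<lambda>x. r (code n x)) (topspace X)"
      unfolding D_def by blast
    have "(\<lambda>x. r (code n x)) \<in> borel_measurable (Baire_algebra X)"
      by (rule measurable_compose[OF code_meas]) simp
    moreover have "f \<in> borel_measurable (Baire_algebra X) \<longleftrightarrow>
        (\<lambda>x. r (code n x)) \<in> borel_measurable (Baire_algebra X)"
      unfolding f by (rule measurable_cong) simp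
    ultimately show "f \<in> Baire_functions X"
      unfolding Baire_functions_eq f by (intro IntI restrict_extensional) simp
  qed
  have "\<exists>s. (\<forall>n. s n \<in> D) \<and> limitin (Baire_function_space X) s f sequentially"
    if f: "f \<in> Baire_functions X" for f
  proof -
    obtain q :: "nat \<Rightarrow> real" where q: "range q = \<rat>"
      using range_from_nat_into[OF _ countable_rat] Rats_0 by blast
    have J_ex: "\<exists>J :: nat \<Rightarrow> nat set. {x \<in> topspace X. f x \<in> ball (q j) (1 / Suc m)} =
        (\<Union>k. topspace X - (\<Union>i\<in>J k. B i))" for m j
      using Baire_sets_vimage_open[OF f open_ball] assms unfolding F_sigma_generating_def by blast
    define J where "J m j = (SOME J :: nat \<Rightarrow> nat set. {x \<in> topspace X. f x \<in> ball (q j) (1 / Suc m)} =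
        (\<Union>k. topspace X - (\<Union>i\<in>J k. B i)))" for m j
    have J: "{x \<in> topspace X. f x \<in> ball (q j) (1 / Suc m)} =
        (\<Union>k. topspace X - (\<Union>i\<in>J m j k. B i))" for m j
      using someI_ex[OF J_ex[of j m]] unfolding J_def .
    \<comment> \<open>A pair \<open>(j, k)\<close>, coded by \<open>p\<close>, stands for the \<open>k\<close>-th closed piece of the set where \<open>f\<close> is
      near \<open>q j\<close>; \<open>v p = q j\<close> is the approximate value there.\<close>
    define I where "I m p = J m (fst (prod_decode p)) (snd (prod_decode p))" for m p
    define v where "v p = q (fst (prod_decode p))" for p
    have cover: "\<exists>p. \<forall>i\<in>I m p. x \<notin> B i" if x: "x \<in> topspace X" for m x
    proof -
      obtain r where "r \<in> \<rat>" "f x < r" "r < f x + 1 / Suc m"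
        using Rats_dense_in_real[of "f x" "f x + 1 / Suc m"] by auto
      moreover from \<open>r \<in> \<rat>\<close> obtain j where "r = q j" unfolding q[symmetric] by (rule rangeE)
      ultimately have "f x \<in> ball (q j) (1 / Suc m)"
        by (simp add: dist_real_def del: of_nat_Suc)
      then obtain k where "\<forall>i\<in>J m j k. x \<notin> B i"
        using J[of j m] x by blast
      then show ?thesis by (intro exI[of _ "prod_encode (j, k)"]) (simp add: I_def)
    qed
    have close: "\<bar>v p - f x\<bar> < 1 / Suc m" if "x \<in> topspace X" "\<forall>i\<in>I m p. x \<notin> B i" for m p x
    proof -
      have "x \<in> (\<Union>k. topspace X - (\<Union>i\<in>J m (fst (prod_decode p)) k. B i))"
        using that unfolding I_def by blast
      then show ?thesis unfolding J[symmetric] by (simp add: v_def dist_real_def)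
    qed
    define g where "g S m n = v (LEAST p. p = n \<or> S \<inter> I m p = {})" for S m n
    have g: "\<forall>\<^sub>F n in sequentially. \<bar>g (code n x) m n - f x\<bar> < 1 / Suc m"
      if x: "x \<in> topspace X" for m x
      using least_index_stabilizes[OF cover[OF x, of m]]
    proof eventually_elim
      case (elim n)
      have "\<forall>i\<in>I m (LEAST p. \<forall>i\<in>I m p. x \<notin> B i). x \<notin> B i"
        using LeastI_ex[OF cover[OF x, of m]] .
      from close[OF x this] show ?case unfolding g_def code_def elim .
    qed
    define s where "s n = restrict (\<lambda>x. restrict (\<lambda>S. diagonal_limit (g S) n) (Pow {..<n}) (code n x))
      (topspace X)" for n
    have "diagonal_limit (g S) n \<in> \<rat>" for S n
      unfolding diagonal_limit_def g_def v_def q[symmetric] by (rule rangeI)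
    then have "restrict (\<lambda>S. diagonal_limit (g S) n) (Pow {..<n}) \<in> Pow {..<n} \<rightarrow>\<^sub>E \<rat>" for n
      by (intro restrict_PiE_iff[THEN iffD2] ballI)
    then have s_D: "s n \<in> D" for n
      unfolding D_def s_def by (intro UN_I[of n] UNIV_I imageI)
    have "(\<lambda>n. s n x) \<longlonglongrightarrow> f x" if x: "x \<in> topspace X" for x
    proof -
      have "s n x = diagonal_limit (\<lambda>m n. g (code n x) m n) n" for n
        using x by (auto simp: s_def code_def diagonal_limit_def)
      then have "(\<lambda>n. s n x) = diagonal_limit (\<lambda>m n. g (code n x) m n)" by auto
      then show ?thesis using diagonal_limit_tendsto[OF g[OF x]] by simp
    qed
    then show ?thesis
      using s_D D_Baire f by (intro exI[of _ s]) (simp add: limitin_Baire_function_space subset_iff)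
  qed
  then show ?thesis
    unfolding sequentially_separable_space_def sequentially_dense_in_def
    using \<open>countable D\<close> D_Baire by (intro exI[of _ D]) simp
qed

section \<open>The O-property and generating families\<close>

lemma metrizable_separable_imp_second_countable:
  assumes "metrizable_space Y" "separable_space Y"
  shows "second_countable Y"
proof -
  obtain M d where "Metric_space M d" and Y: "Y = Metric_space.mtopology M d"
    using assms(1) unfolding metrizable_space_def by blast
  then interpret Metric_space M d by simp
  obtain C where "countable C" "C \<subseteq> M" and C: "mtopology closure_of C = M"
    using assms(2) unfolding separable_space_def Y topspace_mtopology by blast
  define \<B> where "\<B> = (\<lambda>(c, n :: nat). mball c (1 / Suc n)) ` (C \<times> UNIV)"
  have "\<exists>V\<in>\<B>. x \<in> V \<and> V \<subseteq> U" if U: "openin mtopology U" and x: "x \<in> U" for U x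
  proof -
    obtain r where r: "r > 0" "mball x r \<subseteq> U" and xM: "x \<in> M"
      using U x unfolding openin_mtopology by blast
    obtain n :: nat where n: "1 / Suc n < r / 2"
      using reals_Archimedean[of "r / 2"] r by (auto simp: field_simps)
    have "x \<in> mtopology closure_of C" using xM C by simp
    then have "\<exists>c\<in>C. c \<in> mball x (1 / Suc n)"
      unfolding metric_closure_of by (auto simp del: of_nat_Suc)
    then obtain c where c: "c \<in> C" "c \<in> mball x (1 / Suc n)" by blast
    then have cx: "d c x < 1 / Suc n" "c \<in> M" by (simp_all add: commute)
    have "mball c (1 / Suc n) \<subseteq> mball x r"
    proof
      fix y assume "y \<in> mball c (1 / Suc n)"
      then have "y \<in> M" "d c y < 1 / Suc n" by auto
      moreover have "d x y \<le> d x c + d c y" using triangle xM cx \<open>y \<in> M\<close> by blast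
      ultimately show "y \<in> mball x r" using xM cx n commute[of x c] by simp
    qed
    then show ?thesis
      using c cx xM r by (intro bexI[of _ "mball c (1 / Suc n)"]) (auto simp: \<B>_def simp del: of_nat_Suc)
  qed
  moreover have "countable \<B>" unfolding \<B>_def using \<open>countable C\<close> by simp
  moreover have "\<forall>V\<in>\<B>. openin mtopology V" unfolding \<B>_def by auto
  ultimately show ?thesis unfolding second_countable_def Y by blast
qed

text \<open>Pull a countable base of \<open>Y\<close> back along \<open>\<phi>\<close>: a closed set is the complement of the union of
  the basic open sets disjoint from it, and \<open>\<phi>\<close> turns Baire sets into \<open>F\<^sub>\<sigma>\<close> sets.\<close>
lemma O_property_imp_generating:
  assumes "O_property X"
  shows "\<exists>B. F_sigma_generating X B"
proof -
  obtain Y :: "'a topology" and \<phi> where Y: "separable_space Y" "metrizable_space Y"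
    and bij: "bij_betw \<phi> (topspace X) (topspace Y)"
    and pre: "\<And>U. openin Y U \<Longrightarrow> {x \<in> topspace X. \<phi> x \<in> U} \<in> Baire_sets X"
    and img: "\<And>T. T \<in> Baire_sets X \<Longrightarrow> fsigma_in Y (\<phi> ` T)"
    using assms unfolding O_property_def by blast
  from metrizable_separable_imp_second_countable[OF Y(2,1)] obtain \<B> where
    base: "countable \<B> \<and> (\<forall>V \<in> \<B>. openin Y V) \<and>
      (\<forall>U x. openin Y U \<and> x \<in> U \<longrightarrow> (\<exists>V \<in> \<B>. x \<in> V \<and> V \<subseteq> U))"
    unfolding second_countable_def by (rule exE)
  then have "countable \<B>" and \<B>: "\<And>V. V \<in> \<B> \<Longrightarrow> openin Y V"
    "\<And>U x. openin Y U \<Longrightarrow> x \<in> U \<Longrightarrow> \<exists>V \<in> \<B>. x \<in> V \<and> V \<subseteq> U"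
    by metis+
  \<comment> \<open>Adding the empty set makes the base nonempty, so that it is the range of a sequence.\<close>
  define b where "b = from_nat_into (insert {} \<B>)"
  have b: "range b = insert {} \<B>"
    unfolding b_def using \<open>countable \<B>\<close> by (intro range_from_nat_into) simp_all
  have b_open: "openin Y (b i)" for i
  proof -
    have "b i \<in> insert {} \<B>" unfolding b[symmetric] by (rule rangeI)
    then show ?thesis using \<B>(1) by auto
  qed
  define B where "B i = {x \<in> topspace X. \<phi> x \<in> b i}" for i
  have "B i \<in> Baire_sets X" for i unfolding B_def by (rule pre[OF b_open])
  moreover have "\<exists>I :: nat \<Rightarrow> nat set. T = (\<Union>k. topspace X - (\<Union>i\<in>I k. B i))"
    if T: "T \<in> Baire_sets X" for T
  proof -
    obtain C :: "nat \<Rightarrow> 'a set" where C: "\<And>n. closedin Y (C n)" "\<Union> (range C) = \<phi> ` T"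
      using img[OF T] unfolding fsigma_in_ascending by blast
    have TX: "T \<subseteq> topspace X"
      using T sets.sets_into_space[of T "Baire_algebra X"] by (simp add: sets_Baire_algebra)
    define I where "I k = {i. b i \<subseteq> topspace Y - C k}" for k
    have mem: "y \<in> C k \<longleftrightarrow> (\<forall>i\<in>I k. y \<notin> b i)" if y: "y \<in> topspace Y" for k y
    proof
      assume R: "\<forall>i\<in>I k. y \<notin> b i"
      show "y \<in> C k"
      proof (rule ccontr)
        assume "y \<notin> C k"
        moreover have "openin Y (topspace Y - C k)" using C(1) by blast
        ultimately obtain V where V: "V \<in> \<B>" "y \<in> V" "V \<subseteq> topspace Y - C k"
          using \<B>(2) y by blast
        then have "V \<in> range b" using b by blast
        then obtain i where "V = b i" by blast
        with V R show False by (auto simp: I_def)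
      qed
    qed (auto simp: I_def)
    have "x \<in> T \<longleftrightarrow> (\<exists>k. \<forall>i\<in>I k. x \<notin> B i)" if x: "x \<in> topspace X" for x
    proof -
      have y: "\<phi> x \<in> topspace Y" using bij x by (auto simp: bij_betw_def)
      have "x \<in> T \<longleftrightarrow> \<phi> x \<in> \<phi> ` T"
        using inj_on_image_mem_iff[OF bij_betw_imp_inj_on[OF bij] x TX] by simp
      also have "\<dots> \<longleftrightarrow> (\<exists>k. \<phi> x \<in> C k)" unfolding C(2)[symmetric] by blast
      also have "\<dots> \<longleftrightarrow> (\<exists>k. \<forall>i\<in>I k. x \<notin> B i)" using x by (simp add: mem[OF y] B_def)
      finally show ?thesis .
    qed
    then have "T = {x \<in> topspace X. \<exists>k. \<forall>i\<in>I k. x \<notin> B i}" using TX by blast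
    also have "\<dots> = (\<Union>k. topspace X - (\<Union>i\<in>I k. B i))" by auto
    finally show ?thesis by (rule exI[of _ I])
  qed
  ultimately show ?thesis unfolding F_sigma_generating_def by blast
qed

text \<open>Zero-sets separate the points of a Tychonoff space, and every zero-set is assembled from
  the \<open>B i\<close>.\<close>
lemma generating_separates_points:
  assumes "Tychonoff_space X" "F_sigma_generating X B"
    and x: "x \<in> topspace X" "y \<in> topspace X" "x \<noteq> y"
  shows "\<exists>i. (x \<in> B i) \<noteq> (y \<in> B i)"
proof -
  have "closedin X {y}"
    using assms(1) x(2) by (simp add: Tychonoff_space_def closedin_Hausdorff_singleton)
  moreover have "x \<in> topspace X - {y}" using x by simp
  ultimately obtain f where f: "continuous_map X euclideanreal f" "f x = 0" "f ` {y} \<subseteq> {1}"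
    using assms(1) unfolding Tychonoff_space_def completely_regular_space_alt by blast
  define T where "T = {x \<in> topspace X. f x = 0}"
  have "T \<in> zero_sets X" unfolding T_def zero_sets_def using f(1) by (intro CollectI exI[of _ f]) simp
  then have "T \<in> Baire_sets X" unfolding Baire_sets_def by (rule sigma_sets.Basic)
  then obtain I :: "nat \<Rightarrow> nat set" where I: "T = (\<Union>k. topspace X - (\<Union>i\<in>I k. B i))"
    using assms(2) unfolding F_sigma_generating_def by blast
  have "x \<in> T" using x f by (simp add: T_def)
  then obtain k where k: "x \<notin> (\<Union>i\<in>I k. B i)" unfolding I by blast
  have "y \<notin> T" using f by (simp add: T_def)
  then have "y \<in> (\<Union>i\<in>I k. B i)" unfolding I using x(2) by blast
  with k show ?thesis by blast
qed

text \<open>Let \<open>Y\<close> carry the topology that makes \<open>x \<mapsto> (indicator (B i) x)\<^sub>i\<close> an embedding into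
  \<open>\<real>\<^sup>\<nat>\<close>, which is separable and metrizable. The map is injective because the \<open>B i\<close> separate points.
  It is Baire measurable, so open sets of \<open>Y\<close> are Baire sets, and the \<open>B i\<close> are open in \<open>Y\<close>, so
  Baire sets are \<open>F\<^sub>\<sigma>\<close> in \<open>Y\<close>; the bijection is the identity.\<close>
lemma generating_imp_O_property:
  assumes X: "Tychonoff_space X" and B: "F_sigma_generating X B"
  shows "O_property X"
proof -
  define e :: "'a \<Rightarrow> nat \<Rightarrow> real" where "e x i = indicator (B i) x" for x i
  define Y where "Y = pullback_topology (topspace X) e euclidean"
  have topY: "topspace Y = topspace X" by (auto simp: Y_def topspace_pullback_topology)
  have inj: "inj_on e (topspace X)"
  proof (rule inj_onI, rule ccontr)
    fix x y assume xy: "x \<in> topspace X" "y \<in> topspace X" "e x = e y" "x \<noteq> y"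
    then obtain i where "(x \<in> B i) \<noteq> (y \<in> B i)" using generating_separates_points[OF X B] by blast
    then have "e x i \<noteq> e y i" by (auto simp: e_def indicator_def)
    with xy(3) show False by simp
  qed
  have "homeomorphic_map Y (top_of_set (e ` topspace X)) e"
    unfolding homeomorphic_eq_everything_map
  proof (intro conjI)
    show "continuous_map Y (top_of_set (e ` topspace X)) e"
      unfolding continuous_map_in_subtopology
    proof
      show "continuous_map Y euclidean e"
        using continuous_map_pullback[OF continuous_map_id, of "topspace X" e euclidean]
        by (simp add: Y_def)
    qed (simp add: topY)
    show "open_map Y (top_of_set (e ` topspace X)) e"
      unfolding open_map_def
    proof (intro allI impI)
      fix U assume "openin Y U"
      then obtain V where "open V" "U = e -` V \<inter> topspace X"
        by (auto simp: Y_def openin_pullback_topology)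
      then have "e ` U = e ` topspace X \<inter> V" by blast
      then show "openin (top_of_set (e ` topspace X)) (e ` U)"
        using \<open>open V\<close> by (auto simp: openin_open)
    qed
    show "closed_map Y (top_of_set (e ` topspace X)) e"
      unfolding closed_map_def
    proof (intro allI impI)
      fix U assume "closedin Y U"
      then have U: "U \<subseteq> topspace X" "openin Y (topspace X - U)" by (auto simp: closedin_def topY)
      then obtain V where V: "open V" "topspace X - U = e -` V \<inter> topspace X"
        by (auto simp: Y_def openin_pullback_topology)
      have "e ` U = e ` topspace X \<inter> (- V)" using U V(2) by blast
      then show "closedin (top_of_set (e ` topspace X)) (e ` U)"
        using V(1) by (auto simp: closedin_closed)
    qed
    show "e ` topspace Y = topspace (top_of_set (e ` topspace X))" by (simp add: topY)
    show "inj_on e (topspace Y)" using inj by (simp add: topY)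
  qed
  then have homeo: "Y homeomorphic_space top_of_set (e ` topspace X)"
    by (rule homeomorphic_map_imp_homeomorphic_space)
  have "metrizable_space Y"
    unfolding homeomorphic_metrizable_space[OF homeo]
    by (intro metrizable_space_subtopology metrizable_space_euclidean)
  moreover have "second_countable (euclidean :: (nat \<Rightarrow> real) topology)"
  proof -
    obtain \<B> :: "(nat \<Rightarrow> real) set set" where "countable \<B>" "topological_basis \<B>"
      using ex_countable_basis by blast
    then show ?thesis
      unfolding second_countable_def
    proof (intro exI[of _ \<B>] conjI ballI allI impI)
      show "openin euclidean V" if "V \<in> \<B>" for V
        using topological_basis_open[OF \<open>topological_basis \<B>\<close> that] by simp
      show "\<exists>V\<in>\<B>. z \<in> V \<and> V \<subseteq> U" if "openin euclidean U \<and> z \<in> U" for U z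
      proof -
        have "open U" "z \<in> U" using that by simp_all
        then obtain V where "V \<in> \<B>" "z \<in> V" "V \<subseteq> U"
          by (rule topological_basisE[OF \<open>topological_basis \<B>\<close>])
        then show ?thesis by (intro bexI[of _ V] conjI)
      qed
    qed
  qed
  then have "second_countable Y"
    unfolding homeomorphic_space_second_countability[OF homeo] by (rule second_countable_subtopology)
  then have "separable_space Y" by (rule second_countable_imp_separable_space)
  moreover have "bij_betw id (topspace X) (topspace Y)" by (simp add: topY)
  moreover have "{x \<in> topspace X. id x \<in> U} \<in> Baire_sets X" if "openin Y U" for U
  proof -
    from that obtain V where V: "open V" "U = e -` V \<inter> topspace X"
      by (auto simp: Y_def openin_pullback_topology)
    have "B i \<in> sets (Baire_algebra X)" for i
      using B unfolding F_sigma_generating_def sets_Baire_algebra by blast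
    then have "(\<lambda>x. e x i) \<in> borel_measurable (Baire_algebra X)" for i
      unfolding e_def by (rule borel_measurable_indicator)
    then have "e \<in> borel_measurable (Baire_algebra X)"
      by (rule measurable_coordinatewise_then_product)
    from measurable_sets[OF this, of V] V have "U \<in> Baire_sets X"
      by (simp add: sets_Baire_algebra)
    moreover have "{x \<in> topspace X. id x \<in> U} = U" using V by auto
    ultimately show ?thesis by simp
  qed
  moreover have "fsigma_in Y (id ` T)" if T: "T \<in> Baire_sets X" for T
  proof -
    obtain I :: "nat \<Rightarrow> nat set" where I: "T = (\<Union>k. topspace X - (\<Union>i\<in>I k. B i))"
      using B T unfolding F_sigma_generating_def by blast
    have "openin Y (\<Union>i\<in>I k. B i)" for k
    proof (intro openin_Union ballI, elim imageE, clarify)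
      fix i
      have "B i \<subseteq> topspace X"
        using B sets.sets_into_space[of "B i" "Baire_algebra X"]
        by (auto simp: F_sigma_generating_def sets_Baire_algebra)
      then have "B i = e -` {z. z i \<in> {0<..}} \<inter> topspace X"
        by (auto simp: e_def indicator_def)
      moreover have "open {z :: nat \<Rightarrow> real. z i \<in> {0<..}}"
        using open_vimage[OF open_greaterThan continuous_on_product_coordinates]
        by (simp add: vimage_def)
      ultimately show "openin Y (B i)"
        unfolding Y_def openin_pullback_topology by auto
    qed
    then have "fsigma_in Y (topspace X - (\<Union>i\<in>I k. B i))" for k
      unfolding topY[symmetric] by (intro closed_imp_fsigma_in closedin_diff closedin_topspace)
    then show ?thesis unfolding I image_id id_apply by (intro fsigma_in_Union) auto
  qed
  ultimately show ?thesis unfolding O_property_def by blast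
qed

theorem O_property_iff_sequentially_separable:
  assumes "Tychonoff_space X"
  shows "O_property X \<longleftrightarrow> sequentially_separable_space (Baire_function_space X)"
  using assms O_property_imp_generating generating_imp_O_property
    sequentially_separable_imp_generating generating_imp_sequentially_separable by blast

section \<open>From selecting covers to selecting functions\<close>

text \<open>The selection principle for sequences of sets instead of sets of sets, so that
  repetitions and the whole space are admitted. If some \<open>U n k\<close> is the whole space there is nothing
  to select. Otherwise no set occurs as \<open>U n k\<close> for infinitely many \<open>k\<close>, since it would contain every
  point; so \<open>range (U n)\<close> is infinite and is a genuine \<open>\<gamma>\<close>-cover.\<close>
lemma S1_gamma_choice:
  fixes U :: "nat \<Rightarrow> nat \<Rightarrow> 'a set"
  assumes S1: "S1 (Baire_gamma_covers X) (Baire_covers X)"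
    and U: "\<And>n k. U n k \<in> Baire_sets X"
    and ev: "\<And>n x. x \<in> topspace X \<Longrightarrow> \<forall>\<^sub>F k in sequentially. x \<in> U n k"
  shows "\<exists>\<kappa>. \<forall>x\<in>topspace X. \<exists>n. x \<in> U n (\<kappa> n)"
proof (cases "\<exists>n k. U n k = topspace X")
  case True
  then obtain n k where "U n k = topspace X" by blast
  then show ?thesis by (intro exI[of _ "\<lambda>_. k"]) blast
next
  case False
  have sub: "U n k \<subseteq> topspace X" for n k
    using U[of n k] sets.sets_into_space[of _ "Baire_algebra X"] by (simp add: sets_Baire_algebra)
  have "range (U n) \<in> Baire_gamma_covers X" for n
  proof -
    have "infinite (range (U n))"
    proof
      assume "finite (range (U n))"
      then obtain k where k: "infinite {i. U n i = U n k}"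
        using pigeonhole_infinite[of UNIV "U n"] by auto
      have "x \<in> U n k" if x: "x \<in> topspace X" for x
      proof -
        obtain N where N: "\<And>i. i \<ge> N \<Longrightarrow> x \<in> U n i"
          using ev[OF x, of n] unfolding eventually_sequentially by blast
        obtain i where "i \<ge> N" "U n i = U n k"
          using k unfolding infinite_nat_iff_unbounded_le by blast
        with N show ?thesis by blast
      qed
      with sub False show False by blast
    qed
    moreover have "finite {V \<in> range (U n). x \<notin> V}" if x: "x \<in> topspace X" for x
    proof -
      obtain N where N: "\<And>i. i \<ge> N \<Longrightarrow> x \<in> U n i"
        using ev[OF x, of n] unfolding eventually_sequentially by blast
      have "{V \<in> range (U n). x \<notin> V} \<subseteq> U n ` {..<N}"
        using N by (force simp: not_le[symmetric])
      then show ?thesis by (rule finite_subset) simp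
    qed
    moreover have "\<Union> (range (U n)) = topspace X"
    proof
      show "topspace X \<subseteq> \<Union> (range (U n))"
        using ev[of _ n] eventually_happens'[OF sequentially_bot] by blast
    qed (use sub in blast)
    moreover have "topspace X \<notin> range (U n)" using False by blast
    moreover have "range (U n) \<subseteq> Baire_sets X" using U by blast
    ultimately show ?thesis
      unfolding Baire_gamma_covers_def gamma_cover_def nontrivial_cover_def by simp
  qed
  then obtain b where b: "\<And>n. b n \<in> range (U n)" and cov: "range b \<in> Baire_covers X"
    using S1[unfolded S1_def, rule_format, of "\<lambda>n. range (U n)"] by blast
  have "\<forall>n. \<exists>k. b n = U n k" using b by blast
  from choice[OF this] obtain \<kappa> where "\<forall>n. b n = U n (\<kappa> n)" by (rule exE)
  then have \<kappa>: "b n = U n (\<kappa> n)" for n by (rule spec)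
  have "(\<Union>n. b n) = topspace X"
    using cov unfolding Baire_covers_def nontrivial_cover_def by blast
  then show ?thesis unfolding \<kappa> by blast
qed

text \<open>A selection that approximates countably many targets at once. The indices \<open>n\<close> are split into
  infinitely many infinite blocks, one for each target \<open>t j\<close> and accuracy \<open>1/(m+1)\<close>. On such a
  block the sets where the \<open>k\<close>-th term of a sequence in \<open>A n\<close> converging to \<open>t j\<close> is within
  \<open>1/(m+1)\<close> of \<open>t j\<close> eventually contain each given point, so \<open>S1_gamma_choice\<close> selects one term
  per index such that the selected sets cover the space.\<close>
lemma S1_gamma_approximating_choice:
  fixes t :: "nat \<Rightarrow> 'a \<Rightarrow> real" and A :: "nat \<Rightarrow> ('a \<Rightarrow> real) set"
  assumes S1: "S1 (Baire_gamma_covers X) (Baire_covers X)"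
    and A: "\<And>n. A n \<subseteq> Baire_functions X" and t: "\<And>j. t j \<in> Baire_functions X"
    and lim: "\<And>n j. \<exists>s. (\<forall>k. s k \<in> A n) \<and> limitin (Baire_function_space X) s (t j) sequentially"
  shows "\<exists>b. (\<forall>n. b n \<in> A n) \<and>
    (\<forall>x\<in>topspace X. \<forall>j. \<forall>\<epsilon>>0. \<exists>n. \<bar>b n x - t j x\<bar> < \<epsilon>)"
proof -
  define idx where "idx j m l = prod_encode (prod_encode (j, m), l)" for j m l
  define J where "J n = fst (prod_decode (fst (prod_decode n)))" for n
  define M where "M n = snd (prod_decode (fst (prod_decode n)))" for n
  define L where "L n = snd (prod_decode n)" for n
  have [simp]: "J (idx j m l) = j" "M (idx j m l) = m" "L (idx j m l) = l" for j m l
    by (simp_all add: J_def M_def L_def idx_def)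
  have "\<forall>n. \<exists>s. (\<forall>k. s k \<in> A n) \<and> limitin (Baire_function_space X) s (t (J n)) sequentially"
    using lim by blast
  from choice[OF this] obtain s where s_choice: "\<forall>n. (\<forall>k. s n k \<in> A n) \<and>
      limitin (Baire_function_space X) (s n) (t (J n)) sequentially"
    by (rule exE)
  then have s: "s n k \<in> A n"
    and s_lim: "limitin (Baire_function_space X) (s n) (t (J n)) sequentially" for n k
    by simp_all
  have s_Baire: "s n k \<in> Baire_functions X" for n k using s A by blast
  define U where "U n k = {x \<in> topspace X. \<bar>s n k x - t (J n) x\<bar> < 1 / Suc (M n)}" for n k
  have "U n k \<in> Baire_sets X" for n k
  proof -
    have [measurable]: "s n k \<in> borel_measurable (Baire_algebra X)"
      "t (J n) \<in> borel_measurable (Baire_algebra X)"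
      using s_Baire t unfolding Baire_functions_eq by blast+
    have "{x \<in> space (Baire_algebra X). \<bar>s n k x - t (J n) x\<bar> < 1 / Suc (M n)} \<in> sets (Baire_algebra X)"
      by measurable
    then show ?thesis by (simp add: U_def sets_Baire_algebra)
  qed
  moreover have "\<forall>\<^sub>F k in sequentially. x \<in> U n k" if x: "x \<in> topspace X" for n x
  proof -
    have "(\<lambda>k. s n k x) \<longlonglongrightarrow> t (J n) x"
      using s_lim[of n] x unfolding limitin_Baire_function_space[OF s_Baire] by blast
    then have "\<forall>\<^sub>F k in sequentially. dist (s n k x) (t (J n) x) < 1 / Suc (M n)"
      by (rule tendstoD) simp
    then show ?thesis using x by (simp add: U_def dist_real_def)
  qed
  ultimately have \<kappa>_ex: "\<exists>\<kappa>. \<forall>x\<in>topspace X. \<exists>l. x \<in> U (idx j m l) (\<kappa> l)" for j m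
    by (intro S1_gamma_choice[OF S1])
  define \<kappa> where
    "\<kappa> j m = (SOME \<kappa>. \<forall>x\<in>topspace X. \<exists>l. x \<in> U (idx j m l) (\<kappa> l))" for j m
  have \<kappa>: "\<exists>l. x \<in> U (idx j m l) (\<kappa> j m l)" if "x \<in> topspace X" for j m x
    using someI_ex[OF \<kappa>_ex[of j m]] that unfolding \<kappa>_def by (rule bspec)
  define b where "b n = s n (\<kappa> (J n) (M n) (L n))" for n
  have "\<exists>n. \<bar>b n x - t j x\<bar> < \<epsilon>" if x: "x \<in> topspace X" and "\<epsilon> > 0" for x j and \<epsilon> :: real
  proof -
    obtain m :: nat where m: "1 / Suc m < \<epsilon>"
      using reals_Archimedean[OF \<open>\<epsilon> > 0\<close>] by (auto simp: field_simps)
    obtain l where "x \<in> U (idx j m l) (\<kappa> j m l)" using \<kappa>[OF x] by blast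
    then have "\<bar>b (idx j m l) x - t j x\<bar> < 1 / Suc m" by (simp add: U_def b_def)
    with m show ?thesis by (intro exI[of _ "idx j m l"]) linarith
  qed
  moreover have "b n \<in> A n" for n by (simp add: b_def s)
  ultimately show ?thesis by blast
qed

text \<open>The targets are the rational constants.\<close>
lemma S1_gamma_imp_S1_dense_one_dense:
  assumes S1: "S1 (Baire_gamma_covers X) (Baire_covers X)"
  shows "S1 (sequentially_dense_family X) (one_dense_family X)"
  unfolding S1_def
proof (intro allI impI)
  fix A :: "nat \<Rightarrow> ('a \<Rightarrow> real) set"
  assume A: "\<forall>n. A n \<in> sequentially_dense_family X"
  obtain q :: "nat \<Rightarrow> real" where q: "range q = \<rat>"
    using range_from_nat_into[OF _ countable_rat] Rats_0 by blast
  have A_Baire: "A n \<subseteq> Baire_functions X" for n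
    using A by (simp add: sequentially_dense_family_def sequentially_dense_in_def)
  define t where "t j = restrict (\<lambda>x::'a. q j) (topspace X)" for j
  have t: "t j \<in> Baire_functions X" for j unfolding t_def by (rule Baire_functions_const)
  have lim: "\<exists>s. (\<forall>k. s k \<in> A n) \<and> limitin (Baire_function_space X) s (t j) sequentially" for n j
    using A t by (simp add: sequentially_dense_family_def sequentially_dense_in_def)
  obtain b where b: "\<forall>n. b n \<in> A n"
    and approx: "\<forall>x\<in>topspace X. \<forall>j. \<forall>\<epsilon>>0. \<exists>n. \<bar>b n x - t j x\<bar> < \<epsilon>"
    using S1_gamma_approximating_choice[where A = A and t = t, OF S1 A_Baire t lim] by (elim exE conjE)
  have "\<exists>g\<in>range b. g x \<in> W" if x: "x \<in> topspace X" and W: "open W" "W \<noteq> {}" for x W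
  proof -
    obtain w where "w \<in> W" using W by blast
    then obtain e where e: "e > 0" "ball w e \<subseteq> W" using W by (meson openE)
    obtain r where "r \<in> \<rat>" "w < r" "r < w + e / 2"
      using Rats_dense_in_real[of w "w + e / 2"] e by auto
    moreover obtain j where "r = q j" using \<open>r \<in> \<rat>\<close> unfolding q[symmetric] by (rule rangeE)
    moreover obtain n where "\<bar>b n x - q j\<bar> < e / 2"
      using approx[rule_format, OF x, of "e / 2" j] x e by (auto simp: t_def)
    ultimately have "b n x \<in> ball w e"
      unfolding mem_ball dist_real_def by linarith
    with e show ?thesis by blast
  qed
  then show "\<exists>b. (\<forall>n. b n \<in> A n) \<and> range b \<in> one_dense_family X"
    using b A_Baire by (intro exI[of _ b]) (simp add: one_dense_family_def, blast)
qed

text \<open>The single target is \<open>f\<close> itself. The hypothesis on \<open>P\<close> is shared by the sequentially dense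
  sets and by the sets converging to \<open>f\<close>.\<close>
lemma S1_gamma_imp_S1_one_approximating:
  assumes S1: "S1 (Baire_gamma_covers X) (Baire_covers X)" and f: "f \<in> Baire_functions X"
    and P: "\<And>A. A \<in> P \<Longrightarrow> A \<subseteq> Baire_functions X \<and>
      (\<exists>s. (\<forall>k. s k \<in> A) \<and> limitin (Baire_function_space X) s f sequentially)"
  shows "S1 P (one_approximating_family X f)"
  unfolding S1_def
proof (intro allI impI)
  fix A :: "nat \<Rightarrow> ('a \<Rightarrow> real) set"
  assume A: "\<forall>n. A n \<in> P"
  have "\<exists>b. (\<forall>n. b n \<in> A n) \<and>
    (\<forall>x\<in>topspace X. \<forall>j::nat. \<forall>\<epsilon>>0. \<exists>n. \<bar>b n x - f x\<bar> < \<epsilon>)"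
    by (rule S1_gamma_approximating_choice[OF S1]) (use P A f in blast)+
  then obtain b where b: "\<forall>n. b n \<in> A n"
    and approx: "\<And>x \<epsilon>. x \<in> topspace X \<Longrightarrow> \<epsilon> > 0 \<Longrightarrow> \<exists>n. \<bar>b n x - f x\<bar> < \<epsilon>"
    by blast
  have "range b \<subseteq> Baire_functions X" using b A P by blast
  then show "\<exists>b. (\<forall>n. b n \<in> A n) \<and> range b \<in> one_approximating_family X f"
    using b approx by (intro exI[of _ b]) (simp add: one_approximating_family_def)
qed

lemma converging_family_sequence:
  assumes "A \<in> converging_family X f" and f: "f \<in> Baire_functions X"
  shows "\<exists>s. (\<forall>k. s k \<in> A) \<and> limitin (Baire_function_space X) s f sequentially"
proof -
  have A: "countable A" "infinite A" "A \<subseteq> Baire_functions X"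
    and fin: "\<And>U. openin (Baire_function_space X) U \<Longrightarrow> f \<in> U \<Longrightarrow> finite (A - U)"
    using assms(1) unfolding converging_family_def by blast+
  have bij: "bij_betw (from_nat_into A) UNIV A" using A bij_betw_from_nat_into by blast
  have "\<forall>\<^sub>F k in sequentially. from_nat_into A k \<in> U" if "openin (Baire_function_space X) U" "f \<in> U" for U
  proof -
    have "from_nat_into A ` {k. from_nat_into A k \<notin> U} \<subseteq> A - U"
      using bij by (auto simp: bij_betw_def)
    then have "finite (from_nat_into A ` {k. from_nat_into A k \<notin> U})"
      using fin[OF that] by (rule finite_subset)
    then have "finite {k. from_nat_into A k \<notin> U}"
      by (rule finite_imageD) (use bij in \<open>auto simp: bij_betw_def intro: inj_on_subset\<close>)
    then show ?thesis by (simp add: cofinite_eq_sequentially[symmetric] eventually_cofinite)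
  qed
  then have "limitin (Baire_function_space X) (from_nat_into A) f sequentially"
    unfolding limitin_def using f by simp
  moreover have "\<forall>k. from_nat_into A k \<in> A" using bij by (auto simp: bij_betw_def)
  ultimately show ?thesis by blast
qed

section \<open>From selecting functions to selecting covers\<close>

lemma injective_sequence_converging_family:
  assumes "inj s" "\<And>n. s n \<in> Baire_functions X" "f \<notin> range s"
    and "limitin (Baire_function_space X) s f sequentially"
  shows "range s \<in> converging_family X f"
proof -
  have "finite (range s - U)" if U: "openin (Baire_function_space X) U" "f \<in> U" for U
  proof -
    have "\<forall>\<^sub>F k in sequentially. s k \<in> U" using assms(4) U by (simp add: limitin_def)
    then have "finite {k. s k \<notin> U}"
      by (simp add: cofinite_eq_sequentially[symmetric] eventually_cofinite)
    moreover have "range s - U \<subseteq> s ` {k. s k \<notin> U}" by blast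
    ultimately show ?thesis by (meson finite_imageI finite_subset)
  qed
  then show ?thesis
    unfolding converging_family_def using assms range_inj_infinite[OF assms(1)] by auto
qed

lemma gamma_cover_memberD:
  assumes "\<U> \<in> Baire_gamma_covers X" "U \<in> \<U>"
  shows "U \<in> Baire_sets X" "U \<noteq> topspace X" "U \<subseteq> topspace X"
  using assms unfolding Baire_gamma_covers_def gamma_cover_def nontrivial_cover_def by auto

lemma gamma_cover_enumeration:
  assumes "\<U> \<in> Baire_gamma_covers X"
  shows "\<exists>u :: nat \<Rightarrow> 'a set. bij_betw u UNIV \<U> \<and>
    (\<forall>x\<in>topspace X. \<forall>\<^sub>F k in sequentially. x \<in> u k)"
proof -
  have \<U>: "countable \<U>" "infinite \<U>" and fin: "\<And>x. x \<in> topspace X \<Longrightarrow> finite {U \<in> \<U>. x \<notin> U}"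
    using assms unfolding Baire_gamma_covers_def gamma_cover_def by blast+
  have bij: "bij_betw (from_nat_into \<U>) UNIV \<U>" using \<U> bij_betw_from_nat_into by blast
  have "\<forall>\<^sub>F k in sequentially. x \<in> from_nat_into \<U> k" if "x \<in> topspace X" for x
  proof -
    have "from_nat_into \<U> ` {k. x \<notin> from_nat_into \<U> k} \<subseteq> {U \<in> \<U>. x \<notin> U}"
      using bij by (auto simp: bij_betw_def)
    then have "finite (from_nat_into \<U> ` {k. x \<notin> from_nat_into \<U> k})"
      using fin[OF that] by (rule finite_subset)
    then have "finite {k. x \<notin> from_nat_into \<U> k}"
      by (rule finite_imageD) (use bij in \<open>auto simp: bij_betw_def intro: inj_on_subset\<close>)
    then show ?thesis by (simp add: cofinite_eq_sequentially[symmetric] eventually_cofinite)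
  qed
  with bij show ?thesis by blast
qed

text \<open>The common end of both arguments below: if \<open>b n\<close> is bounded away from zero outside some member
  of the \<open>n\<close>-th cover, then a point where \<open>b n\<close> is small lies in that member.\<close>
lemma gamma_cover_selection_of_small_values:
  fixes b :: "nat \<Rightarrow> 'a \<Rightarrow> real"
  assumes \<U>: "\<And>n. \<U> n \<in> Baire_gamma_covers X"
    and large: "\<forall>n. \<exists>U\<in>\<U> n. \<forall>x\<in>topspace X - U. 1 \<le> \<bar>b n x\<bar>"
    and small: "\<forall>x\<in>topspace X. \<exists>n. \<bar>b n x\<bar> < 1"
  shows "\<exists>V. (\<forall>n. V n \<in> \<U> n) \<and> range V \<in> Baire_covers X"
proof -
  from choice[OF large[unfolded Bex_def]] obtain V
    where V: "\<forall>n. V n \<in> \<U> n \<and> (\<forall>x\<in>topspace X - V n. 1 \<le> \<bar>b n x\<bar>)"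
    by (rule exE)
  then have V_mem: "V n \<in> \<U> n" for n by simp
  note V_Baire = gamma_cover_memberD[OF \<U> V_mem]
  have "x \<in> \<Union> (range V)" if x: "x \<in> topspace X" for x
  proof -
    obtain n where n: "\<bar>b n x\<bar> < 1" using bspec[OF small x] by (rule exE)
    have "x \<in> V n"
    proof (rule ccontr)
      assume "x \<notin> V n"
      then have "1 \<le> \<bar>b n x\<bar>" using V x by simp
      with n show False by simp
    qed
    then show ?thesis by (intro UN_I[of n] UNIV_I)
  qed
  then have "\<Union> (range V) = topspace X"
    by (intro equalityI UN_least V_Baire(3) subsetI)
  moreover have "topspace X \<notin> range V"
  proof
    assume "topspace X \<in> range V"
    then obtain n where "topspace X = V n" by (rule rangeE)
    with V_Baire(2)[of n] show False by simp
  qed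
  moreover have "range V \<subseteq> Baire_sets X"
    using V_Baire(1) by (intro image_subsetI)
  ultimately have "range V \<in> Baire_covers X"
    by (simp add: Baire_covers_def nontrivial_cover_def)
  with V_mem show ?thesis
    by (intro exI[of _ V] conjI allI)
qed

text \<open>Replace a member \<open>U\<close> of a \<open>\<gamma>\<close>-cover by the indicator of its complement. Infinitely many
  distinct \<open>U\<close> give infinitely many distinct functions, none is zero because no \<open>U\<close> is the whole
  space, and point-cofiniteness says that they converge to zero.\<close>
lemma S1_converging_imp_S1_gamma:
  assumes "S1 (converging_family X (restrict (\<lambda>x. 0) (topspace X)))
    (one_approximating_family X (restrict (\<lambda>x. 0) (topspace X)))"
  shows "S1 (Baire_gamma_covers X) (Baire_covers X)"
  unfolding S1_def
proof (intro allI impI)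
  fix \<U> :: "nat \<Rightarrow> 'a set set"
  assume "\<forall>n. \<U> n \<in> Baire_gamma_covers X"
  then have \<U>: "\<U> n \<in> Baire_gamma_covers X" for n by (rule spec)
  define zero where "zero = restrict (\<lambda>x::'a. 0::real) (topspace X)"
  define miss :: "'a set \<Rightarrow> 'a \<Rightarrow> real"
    where "miss U = restrict (indicator (topspace X - U)) (topspace X)" for U
  have miss_val: "miss U x = (if x \<in> U then 0 else 1)" if "x \<in> topspace X" for U x
    using that by (simp add: miss_def)
  have "miss ` \<U> n \<in> converging_family X zero" for n
  proof -
    obtain u :: "nat \<Rightarrow> 'a set" where bij: "bij_betw u UNIV (\<U> n)"
      and ev: "\<And>x. x \<in> topspace X \<Longrightarrow> \<forall>\<^sub>F k in sequentially. x \<in> u k"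
      using gamma_cover_enumeration[OF \<U>[of n]] by blast
    have u: "u k \<in> Baire_sets X" "u k \<noteq> topspace X" "u k \<subseteq> topspace X" for k
    proof -
      have "u k \<in> \<U> n" using bij by (auto simp: bij_betw_def)
      then show "u k \<in> Baire_sets X" "u k \<noteq> topspace X" "u k \<subseteq> topspace X"
        by (rule gamma_cover_memberD[OF \<U>])+
    qed
    have miss_Baire: "miss (u k) \<in> Baire_functions X" for k
    proof -
      have "topspace X - u k \<in> Baire_sets X"
        using u(1)[of k] unfolding Baire_sets_def by (rule sigma_sets.Compl)
      then show ?thesis unfolding miss_def by (rule indicator_in_Baire_functions)
    qed
    have "inj (\<lambda>k. miss (u k))"
    proof (rule injI)
      fix k l assume eq: "miss (u k) = miss (u l)"
      have "x \<in> u k \<longleftrightarrow> x \<in> u l" if "x \<in> topspace X" for x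
        using fun_cong[OF eq, of x] that by (simp add: miss_val split: if_splits)
      then have "u k = u l" using u(3) by blast
      then show "k = l" using bij by (simp add: bij_betw_def inj_eq)
    qed
    moreover have "zero \<noteq> miss (u k)" for k
    proof
      assume eq: "zero = miss (u k)"
      obtain x where x: "x \<in> topspace X" "x \<notin> u k" using u(2,3)[of k] by blast
      then show False using fun_cong[OF eq, of x] by (simp add: miss_val zero_def)
    qed
    moreover have "limitin (Baire_function_space X) (\<lambda>k. miss (u k)) zero sequentially"
      unfolding limitin_Baire_function_space[OF miss_Baire]
    proof (intro conjI ballI)
      show "zero \<in> Baire_functions X" unfolding zero_def by (rule Baire_functions_const)
      fix x assume x: "x \<in> topspace X"
      show "(\<lambda>k. miss (u k) x) \<longlonglongrightarrow> zero x"
        using ev[OF x] by (intro tendsto_eventually, eventually_elim) (simp add: miss_val x zero_def)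
    qed
    ultimately have "range (\<lambda>k. miss (u k)) \<in> converging_family X zero"
      by (intro injective_sequence_converging_family miss_Baire) auto
    moreover have "range (\<lambda>k. miss (u k)) = miss ` \<U> n" using bij
      unfolding bij_betw_imp_surj_on[OF bij, symmetric] by (simp add: image_image)
    ultimately show ?thesis by simp
  qed
  then obtain b where b: "\<And>n. b n \<in> miss ` \<U> n" and approx: "range b \<in> one_approximating_family X zero"
    using assms[folded zero_def, unfolded S1_def, rule_format, of "\<lambda>n. miss ` \<U> n"] by blast
  have large: "\<exists>U\<in>\<U> n. \<forall>x\<in>topspace X - U. 1 \<le> \<bar>b n x\<bar>" for n
  proof -
    obtain U where "U \<in> \<U> n" "b n = miss U" using b by blast
    then show ?thesis by (intro bexI[of _ U]) (simp_all add: miss_val)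
  qed
  have small: "\<exists>n. \<bar>b n x\<bar> < 1" if x: "x \<in> topspace X" for x
  proof -
    have "\<exists>h\<in>range b. \<bar>h x - zero x\<bar> < 1"
      using approx x zero_less_one unfolding one_approximating_family_def by blast
    then show ?thesis using x by (auto simp: zero_def)
  qed
  show "\<exists>V. (\<forall>n. V n \<in> \<U> n) \<and> range V \<in> Baire_covers X"
    by (rule gamma_cover_selection_of_small_values[where b = b]) (intro \<U> allI ballI large small)+
qed

text \<open>Given a countable sequentially dense set \<open>D\<close> and a \<open>\<gamma>\<close>-cover, the functions that agree with
  some \<open>d \<in> D\<close> on some member \<open>U\<close> and equal \<open>1\<close> off \<open>U\<close> again form a sequentially dense set: if
  \<open>d k\<close> converges to \<open>f\<close>, so do its modifications off the \<open>k\<close>-th member, since each point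
  eventually stays in the members. A selected function that is small at \<open>x\<close> reveals that \<open>x \<in> U\<close>.
  This is all that is demanded of \<open>Q\<close>, which stands for the \<open>1\<close>-dense sets and for the sets
  approximating zero.\<close>
lemma S1_dense_imp_S1_gamma:
  assumes sep: "sequentially_separable_space (Baire_function_space X)"
    and S1: "S1 (sequentially_dense_family X) Q"
    and small: "\<And>A x. A \<in> Q \<Longrightarrow> x \<in> topspace X \<Longrightarrow> \<exists>g\<in>A. \<bar>g x\<bar> < 1"
  shows "S1 (Baire_gamma_covers X) (Baire_covers X)"
  unfolding S1_def
proof (intro allI impI)
  fix \<U> :: "nat \<Rightarrow> 'a set set"
  assume "\<forall>n. \<U> n \<in> Baire_gamma_covers X"
  then have \<U>: "\<U> n \<in> Baire_gamma_covers X" for n by (rule spec)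
  obtain D where "countable D" and D: "D \<subseteq> Baire_functions X"
    and lim: "\<And>f. f \<in> Baire_functions X \<Longrightarrow>
      \<exists>s. (\<forall>n. s n \<in> D) \<and> limitin (Baire_function_space X) s f sequentially"
    using sep unfolding sequentially_separable_space_def sequentially_dense_in_def by auto
  define patch :: "'a set \<Rightarrow> ('a \<Rightarrow> real) \<Rightarrow> 'a \<Rightarrow> real"
    where "patch U d = restrict (\<lambda>x. if x \<in> U then d x else 1) (topspace X)" for U d
  have patch_val: "patch U d x = (if x \<in> U then d x else 1)" if "x \<in> topspace X" for U d x
    using that by (simp add: patch_def)
  define A where "A n = (\<lambda>(U, d). patch U d) ` (\<U> n \<times> D)" for n
  have patch_Baire: "patch U d \<in> Baire_functions X" if "U \<in> Baire_sets X" "d \<in> Baire_functions X" for U d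
  proof -
    have [measurable]: "U \<in> sets (Baire_algebra X)" "d \<in> borel_measurable (Baire_algebra X)"
      using that by (simp_all add: sets_Baire_algebra Baire_functions_eq)
    have "(\<lambda>x. if x \<in> U then d x else 1) \<in> borel_measurable (Baire_algebra X)" by measurable
    moreover have "patch U d \<in> borel_measurable (Baire_algebra X) \<longleftrightarrow>
        (\<lambda>x. if x \<in> U then d x else 1) \<in> borel_measurable (Baire_algebra X)"
      by (rule measurable_cong) (simp add: patch_val)
    moreover have "patch U d \<in> extensional (topspace X)"
      unfolding patch_def by (rule restrict_extensional)
    ultimately show ?thesis unfolding Baire_functions_eq by (intro IntI) simp_all
  qed
  have "A n \<in> sequentially_dense_family X" for n
  proof -
    have \<U>n: "countable (\<U> n)" "\<U> n \<subseteq> Baire_sets X"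
      using \<U>[of n] by (simp_all add: Baire_gamma_covers_def)
    obtain u :: "nat \<Rightarrow> 'a set" where bij: "bij_betw u UNIV (\<U> n)"
      and ev: "\<And>x. x \<in> topspace X \<Longrightarrow> \<forall>\<^sub>F k in sequentially. x \<in> u k"
      using gamma_cover_enumeration[OF \<U>[of n]] by blast
    have u: "u k \<in> \<U> n" for k using bij by (auto simp: bij_betw_def)
    have "countable (A n)" unfolding A_def using \<U>n \<open>countable D\<close> by simp
    moreover have "A n \<subseteq> Baire_functions X"
      unfolding A_def using \<U>n D by (auto intro!: patch_Baire)
    moreover have "\<exists>s. (\<forall>n'. s n' \<in> A n) \<and> limitin (Baire_function_space X) s f sequentially"
      if f: "f \<in> Baire_functions X" for f
    proof -
      obtain d where d: "\<And>k. d k \<in> D" and d_lim: "limitin (Baire_function_space X) d f sequentially"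
        using lim[OF f] by blast
      have dB: "d k \<in> Baire_functions X" for k using d D by blast
      have pB: "patch (u k) (d k) \<in> Baire_functions X" for k
        using u \<U>n dB by (intro patch_Baire) auto
      have "(\<lambda>k. patch (u k) (d k) x) \<longlonglongrightarrow> f x" if x: "x \<in> topspace X" for x
      proof (rule Lim_transform_eventually)
        show "(\<lambda>k. d k x) \<longlonglongrightarrow> f x"
          using d_lim x unfolding limitin_Baire_function_space[OF dB] by blast
        show "\<forall>\<^sub>F k in sequentially. d k x = patch (u k) (d k) x"
          using ev[OF x] by eventually_elim (simp add: patch_val x)
      qed
      then have "limitin (Baire_function_space X) (\<lambda>k. patch (u k) (d k)) f sequentially"
        using f by (simp add: limitin_Baire_function_space[OF pB])
      moreover have "patch (u k) (d k) \<in> A n" for k unfolding A_def using u d by force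
      ultimately show ?thesis by (intro exI[of _ "\<lambda>k. patch (u k) (d k)"]) simp
    qed
    ultimately show ?thesis
      by (simp add: sequentially_dense_family_def sequentially_dense_in_def)
  qed
  then obtain b where b: "\<And>n. b n \<in> A n" and Q: "range b \<in> Q"
    using S1[unfolded S1_def, rule_format, of A] by blast
  have large: "\<exists>U\<in>\<U> n. \<forall>x\<in>topspace X - U. 1 \<le> \<bar>b n x\<bar>" for n
  proof -
    obtain U d where "U \<in> \<U> n" "b n = patch U d" using b[of n] unfolding A_def by auto
    then show ?thesis by (intro bexI[of _ U]) (simp_all add: patch_val)
  qed
  have small: "\<exists>n. \<bar>b n x\<bar> < 1" if x: "x \<in> topspace X" for x
    using small[OF Q x] by blast
  show "\<exists>V. (\<forall>n. V n \<in> \<U> n) \<and> range V \<in> Baire_covers X"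
    by (rule gamma_cover_selection_of_small_values[where b = b]) (intro \<U> allI ballI large small)+
qed

theorem theorem9p2:
  fixes X :: "'a topology"
  assumes "Tychonoff_space X"
  shows
    "((S1 (sequentially_dense_family X) (one_dense_family X) \<and>
       sequentially_separable_space (Baire_function_space X))
      \<longleftrightarrow>
      (S1 (Baire_gamma_covers X) (Baire_covers X) \<and> O_property X))
     \<and>
     ((S1 (Baire_gamma_covers X) (Baire_covers X) \<and> O_property X)
      \<longleftrightarrow>
      (sequentially_separable_space (Baire_function_space X) \<and>
       (\<forall>f \<in> Baire_functions X. S1 (converging_family X f) (one_approximating_family X f))))
     \<and>
     ((sequentially_separable_space (Baire_function_space X) \<and>
       (\<forall>f \<in> Baire_functions X. S1 (converging_family X f) (one_approximating_family X f)))
      \<longleftrightarrow>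
      (sequentially_separable_space (Baire_function_space X) \<and>
       (\<forall>f \<in> Baire_functions X.
          S1 (sequentially_dense_family X) (one_approximating_family X f))))"
proof -
  let ?zero = "restrict (\<lambda>x. 0) (topspace X) :: 'a \<Rightarrow> real"
  let ?sep = "sequentially_separable_space (Baire_function_space X)"
  let ?S1\<gamma> = "S1 (Baire_gamma_covers X) (Baire_covers X)"
  have zero: "?zero \<in> Baire_functions X" by (rule Baire_functions_const)
  note O = O_property_iff_sequentially_separable[OF assms]
  have one: "?S1\<gamma>" if ?sep "S1 (sequentially_dense_family X) (one_dense_family X)"
  proof (rule S1_dense_imp_S1_gamma[OF that])
    fix A x assume "A \<in> one_dense_family X" "x \<in> topspace X"
    then have "\<forall>W. open W \<and> W \<noteq> {} \<longrightarrow> (\<exists>g\<in>A. g x \<in> W)"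
      by (simp add: one_dense_family_def)
    from this[rule_format, of "{-1<..<1}"] have "\<exists>g\<in>A. g x \<in> {-1<..<1}" by simp
    then show "\<exists>g\<in>A. \<bar>g x\<bar> < 1" by (simp add: abs_less_iff minus_less_iff conj_commute)
  qed
  have three: "?S1\<gamma>" if "\<forall>f \<in> Baire_functions X. S1 (converging_family X f) (one_approximating_family X f)"
    using that zero by (blast intro: S1_converging_imp_S1_gamma)
  have four: "?S1\<gamma>" if ?sep
    "\<forall>f \<in> Baire_functions X. S1 (sequentially_dense_family X) (one_approximating_family X f)"
  proof (rule S1_dense_imp_S1_gamma[OF that(1) bspec[OF that(2) zero]])
    fix A x assume "A \<in> one_approximating_family X ?zero" "x \<in> topspace X"
    then have "\<exists>g\<in>A. \<bar>g x - ?zero x\<bar> < 1"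
      unfolding one_approximating_family_def using zero_less_one by blast
    then show "\<exists>g\<in>A. \<bar>g x\<bar> < 1" using \<open>x \<in> topspace X\<close> by simp
  qed
  have to_three: "S1 (converging_family X f) (one_approximating_family X f)"
    if ?S1\<gamma> "f \<in> Baire_functions X" for f
    by (rule S1_gamma_imp_S1_one_approximating[OF that])
      (use converging_family_sequence that(2) in \<open>auto simp: converging_family_def\<close>)
  have to_four: "S1 (sequentially_dense_family X) (one_approximating_family X f)"
    if ?S1\<gamma> "f \<in> Baire_functions X" for f
    by (rule S1_gamma_imp_S1_one_approximating[OF that])
      (use that(2) in \<open>auto simp: sequentially_dense_family_def sequentially_dense_in_def\<close>)
  show ?thesis
    unfolding O using one three four to_three to_four S1_gamma_imp_S1_dense_one_dense by blast
qed

end
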